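(* (Goddard uniqueness) Let $\mathbb V=\bigoplus_{n\in\mathbb N}\mathbb V(n)$ be graded by a diagonalizable operator $L_0$, and let $\mathcal E$ be a set of $L_0$-homogeneous fields on $\mathbb V$ satisfying: (1) there is a distinguished vector $\mathbf 1\in\mathbb V(0)$ such that $A(z)\mathbf 1$ has no negative powers of $z$ for all $A(z)\in\mathcal E$; (2) there is a distinguished $L_{-1}\in\mathrm{End}(\mathbb V)$ such that $L_{-1}\mathbf 1=0$ and $[L_{-1},A(z)]=\partial_zA(z)$ for all $A(z)\in\mathcal E$; (3) the vectors $A^1_{n_1}\cdots A^k_{n_k}\mathbf 1$ (where $k\in\mathbb N$, $A^1(z),\dots,A^k(z)\in\mathcal E$, $n_1,\dots,n_k\in\mathbb Z$) span $\mathbb V$; (4) any two fields of $\mathcal E$ are local. If $A^1(z),A^2(z)\in\mathcal E$ satisfy $A^1_{-1}\mathbf 1=A^2_{-1}\mathbf 1$, then $A^1(z)=A^2(z)$.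
   Context: All vector spaces are over $\mathbb C$. $L_0$ acts on $\mathbb V(n)$ as $n$; the $\mathbb V(n)$ need not be finite-dimensional. A homogeneous field on $\mathbb V$ is a formal series $A(z)=\sum_{n\in\mathbb Z}A_nz^{-n-1}$ with $A_n\in\mathrm{End}(\mathbb V)$ such that for some integer $\Delta_A$, $[L_0,A_n]=(\Delta_A-n-1)A_n$ for all $n\in\mathbb Z$. Fields $A(z),B(z)$ are local if there are $M\in\mathbb N$ and $C^l(z)=\sum_nC^l_nz^{-n-1}\in\mathrm{End}(\mathbb V)[[z^{\pm1}]]$ ($0\le l\le M-1$) with $[A_m,B_k]=\sum_{l=0}^{M-1}\binom mlC^l_{m+k-l}$ for all $m,k\in\mathbb Z$. (Equivalently, $(z_1-z_2)^N[A(z_1),B(z_2)]=0$ for some $N\in\mathbb N$.) *)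

theory Defs
  imports Complex_Main
begin

text \<open>
  A formal series in \<open>End(V)[[z, z^-1]]\<close> is given by its coefficient function:
  \<open>A k\<close> is the coefficient of \<open>z^k\<close>. The complex vector space \<open>V\<close> is the whole type \<open>'v\<close>
  with scalar multiplication \<open>scale\<close>.
\<close>

type_synonym 'v formal_series = "int \<Rightarrow> 'v \<Rightarrow> 'v"

definition end_series :: "(complex \<Rightarrow> 'v::ab_group_add \<Rightarrow> 'v) \<Rightarrow> 'v formal_series \<Rightarrow> bool" where
  "end_series scale A \<longleftrightarrow> (\<forall>k. Vector_Spaces.linear scale scale (A k))"

text \<open>The modes \<open>A\<^sub>n\<close> are defined by \<open>A(z) = (\<Sum>n. A\<^sub>n z^(-n-1))\<close>.\<close>

definition mode :: "'v formal_series \<Rightarrow> int \<Rightarrow> 'v \<Rightarrow> 'v" where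
  "mode A n = A (- n - 1)"

definition series_deriv ::
  "(complex \<Rightarrow> 'v::ab_group_add \<Rightarrow> 'v) \<Rightarrow> 'v formal_series \<Rightarrow> 'v formal_series" where
  "series_deriv scale A = (\<lambda>k v. scale (of_int (k + 1)) (A (k + 1) v))"

definition commutator :: "('v::ab_group_add \<Rightarrow> 'v) \<Rightarrow> ('v \<Rightarrow> 'v) \<Rightarrow> 'v \<Rightarrow> 'v" where
  "commutator S T = (\<lambda>v. S (T v) - T (S v))"

definition direct_sum_decomposition ::
  "(complex \<Rightarrow> 'v::ab_group_add \<Rightarrow> 'v) \<Rightarrow> (nat \<Rightarrow> 'v set) \<Rightarrow> bool" where
  "direct_sum_decomposition scale V \<longleftrightarrow>
     (\<forall>n. module.subspace scale (V n)) \<and>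
     (\<forall>v. \<exists>!f. (\<forall>n. f n \<in> V n) \<and> finite {n. f n \<noteq> 0} \<and> v = (\<Sum>n | f n \<noteq> 0. f n))"

definition graded_by ::
  "(complex \<Rightarrow> 'v::ab_group_add \<Rightarrow> 'v) \<Rightarrow> ('v \<Rightarrow> 'v) \<Rightarrow> (nat \<Rightarrow> 'v set) \<Rightarrow> bool" where
  "graded_by scale L0 V \<longleftrightarrow>
     Vector_Spaces.linear scale scale L0 \<and> direct_sum_decomposition scale V \<and>
     (\<forall>n. \<forall>v\<in>V n. L0 v = scale (of_nat n) v)"

definition homogeneous_field ::
  "(complex \<Rightarrow> 'v::ab_group_add \<Rightarrow> 'v) \<Rightarrow> ('v \<Rightarrow> 'v) \<Rightarrow> 'v formal_series \<Rightarrow> bool" where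
  "homogeneous_field scale L0 A \<longleftrightarrow> end_series scale A \<and>
     (\<exists>\<Delta>::int. \<forall>n. commutator L0 (mode A n) = (\<lambda>v. scale (of_int (\<Delta> - n - 1)) (mode A n v)))"

definition local_fields ::
  "(complex \<Rightarrow> 'v::ab_group_add \<Rightarrow> 'v) \<Rightarrow> 'v formal_series \<Rightarrow> 'v formal_series \<Rightarrow> bool" where
  "local_fields scale A B \<longleftrightarrow>
     (\<exists>(M::nat) (C :: nat \<Rightarrow> 'v formal_series).
        (\<forall>l<M. end_series scale (C l)) \<and>
        (\<forall>m k. commutator (mode A m) (mode B k) =
           (\<lambda>v. \<Sum>l<M. scale (of_int m gchoose l) (mode (C l) (m + k - int l) v))))"

text \<open>
  \<open>mode_product [(A1, n1), \<dots>, (Ak, nk)] v\<close> is \<open>A1\<^sub>n\<^sub>1 (\<dots> (Ak\<^sub>n\<^sub>k v))\<close>.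
\<close>

definition mode_product :: "('v formal_series \<times> int) list \<Rightarrow> 'v \<Rightarrow> 'v" where
  "mode_product xs v = foldr (\<lambda>(A, n). mode A n) xs v"

end

theory Submission imports Defs begin

text \<open>
  The difference \<open>D(z) = A\<^sup>1(z) - A\<^sup>2(z)\<close> inherits from the two fields translation
  covariance, the creation property on the vacuum, and locality with respect to every field of
  the generating family. Two facts about such a \<open>D\<close> give the theorem.

  First, \<open>D(z)\<close> kills the vacuum (\<open>creation_determined\<close>). Translation covariance and
  \<open>L\<^sub>-\<^sub>1 vac = 0\<close> give \<open>L\<^sub>-\<^sub>1 (D\<^sub>-\<^sub>k\<^sub>-\<^sub>1 vac) = (k + 1) D\<^sub>-\<^sub>k\<^sub>-\<^sub>2 vac\<close>, so the power
  series \<open>D(z) vac\<close> is determined by its constant term \<open>D\<^sub>-\<^sub>1 vac\<close>, which is zero by hypothesis.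

  Second, if all modes of \<open>D\<close> kill \<open>u\<close>, then they kill \<open>B\<^sub>k u\<close> for every field \<open>B\<close> of the
  family (\<open>annihilation_propagates\<close>). Indeed, locality turns \<open>D\<^sub>m B\<^sub>k u = [D\<^sub>m, B\<^sub>k] u\<close>, for
  \<open>m + k\<close> fixed, into a polynomial in \<open>m\<close> with coefficients in the vector space. Since the
  grading is bounded below, \<open>B\<^sub>k u = 0\<close> for large \<open>k\<close> (\<open>modes_truncate\<close>), that is, for very
  negative \<open>m\<close>; so this polynomial has infinitely many zeros and vanishes.

  Hence the modes of \<open>D\<close> kill all vectors obtained from the vacuum by applying modes, and these
  span the space.
\<close>

section \<open>Binomial polynomials and differences of local fields\<close>

locale complex_space = vector_space scale
  for scale :: "complex \<Rightarrow> 'v::ab_group_add \<Rightarrow> 'v"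
begin

lemma linear_hom: "Vector_Spaces.linear scale scale f \<Longrightarrow> module_hom scale scale f"
  by (rule Vector_Spaces.linear.axioms(3))

lemma linear_diff_fun:
  assumes "Vector_Spaces.linear scale scale f" "Vector_Spaces.linear scale scale g"
  shows "Vector_Spaces.linear scale scale (\<lambda>v. f v - g v)"
proof -
  interpret vector_space_pair scale scale ..
  show ?thesis by (rule linear_compose_sub[OF assms])
qed

lemma linear_zero_fun: "Vector_Spaces.linear scale scale (\<lambda>v. 0)"
proof -
  interpret vector_space_pair scale scale ..
  show ?thesis by (rule linear_zero)
qed

text \<open>
  The forward difference in \<open>m\<close> sends \<open>m gchoose Suc l\<close> to \<open>m gchoose l\<close>, so it lowers the degree
  and shifts the coefficients; this makes the induction on the number of coefficients work.
\<close>

lemma binomial_polynomial_vanishing: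
  fixes c :: "nat \<Rightarrow> 'v" and m0 :: int
  assumes "\<And>m. m \<le> m0 \<Longrightarrow> (\<Sum>l<M. scale (of_int m gchoose l) (c l)) = 0"
  shows "\<forall>l<M. c l = 0"
  using assms
proof (induction M arbitrary: c m0)
  case 0
  then show ?case by simp
next
  case (Suc M)
  have "(\<Sum>l<M. scale (of_int m gchoose l) (c (Suc l))) = 0" if "m \<le> m0 - 1" for m
  proof -
    have pascal: "(of_int (m + 1) gchoose Suc l :: complex) - (of_int m gchoose Suc l)
        = of_int m gchoose l" for l
      by (simp add: gbinomial_Suc_Suc)
    have "(\<Sum>l<M. scale (of_int m gchoose l) (c (Suc l)))
        = (\<Sum>l<M. scale ((of_int (m + 1) gchoose Suc l) - (of_int m gchoose Suc l)) (c (Suc l)))"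
      by (simp only: pascal)
    also have "\<dots> = (\<Sum>l<Suc M. scale (of_int (m + 1) gchoose l) (c l))
          - (\<Sum>l<Suc M. scale (of_int m gchoose l) (c l))"
      unfolding sum.lessThan_Suc_shift scale_left_diff_distrib sum_subtractf by simp
    also have "\<dots> = 0"
      using Suc.prems[of "m + 1"] Suc.prems[of m] that by simp
    finally show ?thesis .
  qed
  then have tail: "\<forall>l<M. c (Suc l) = 0"
    by (rule Suc.IH)
  have "c 0 = 0"
    using Suc.prems[of m0] tail unfolding sum.lessThan_Suc_shift by simp
  with tail show ?case
    by (metis less_Suc_eq_0_disj)
qed

text \<open>
  The coefficient families of two locality relations may have different lengths; padding both by
  zero to the maximum length makes them subtractable.
\<close>

lemma local_fields_diff:
  assumes "local_fields scale A B" "local_fields scale A' B" "end_series scale B"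
  shows "local_fields scale (\<lambda>k v. A k v - A' k v) B"
proof -
  obtain M C where C: "\<forall>l<M. end_series scale (C l)"
    "\<And>m k. commutator (mode A m) (mode B k) =
       (\<lambda>v. \<Sum>l<M. scale (of_int m gchoose l) (mode (C l) (m + k - int l) v))"
    using assms(1) unfolding local_fields_def by blast
  obtain M' C' where C': "\<forall>l<M'. end_series scale (C' l)"
    "\<And>m k. commutator (mode A' m) (mode B k) =
       (\<lambda>v. \<Sum>l<M'. scale (of_int m gchoose l) (mode (C' l) (m + k - int l) v))"
    using assms(2) unfolding local_fields_def by blast
  define P where "P l = (if l < M then C l else (\<lambda>k v. 0))" for l
  define P' where "P' l = (if l < M' then C' l else (\<lambda>k v. 0))" for l
  define N where "N = max M M'"
  have lin: "end_series scale (P l)" "end_series scale (P' l)" for l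
    using C(1) C'(1) by (auto simp: P_def P'_def end_series_def linear_zero_fun)
  have P: "(\<Sum>l<M. scale (of_int m gchoose l) (mode (C l) (m + k - int l) v))
      = (\<Sum>l<N. scale (of_int m gchoose l) (mode (P l) (m + k - int l) v))" for m k v
    by (rule sum.mono_neutral_cong_left) (auto simp: N_def P_def mode_def)
  have P': "(\<Sum>l<M'. scale (of_int m gchoose l) (mode (C' l) (m + k - int l) v))
      = (\<Sum>l<N. scale (of_int m gchoose l) (mode (P' l) (m + k - int l) v))" for m k v
    by (rule sum.mono_neutral_cong_left) (auto simp: N_def P'_def mode_def)
  have "commutator (mode (\<lambda>k v. A k v - A' k v) m) (mode B k) v
      = (\<Sum>l<N. scale (of_int m gchoose l)
           (mode (\<lambda>k v. P l k v - P' l k v) (m + k - int l) v))" for m k v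
  proof -
    have "mode B k (x - y) = mode B k x - mode B k y" for x y
      using assms(3) module_hom.diff[OF linear_hom] unfolding end_series_def mode_def by blast
    then have "commutator (mode (\<lambda>k v. A k v - A' k v) m) (mode B k) v
        = commutator (mode A m) (mode B k) v - commutator (mode A' m) (mode B k) v"
      by (simp add: commutator_def mode_def)
    then show ?thesis
      unfolding C(2) C'(2) P P'
      by (simp add: mode_def scale_right_diff_distrib sum_subtractf)
  qed
  moreover have "end_series scale (\<lambda>k v. P l k v - P' l k v)" for l
    using lin[of l] unfolding end_series_def by (auto intro: linear_diff_fun)
  ultimately show ?thesis
    unfolding local_fields_def by (intro exI[of _ N] exI[of _ "\<lambda>l k v. P l k v - P' l k v"]) auto
qed

section \<open>Truncation of homogeneous fields\<close>

text \<open>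
  All eigenvalues of the grading operator are natural numbers: comparing the components of
  \<open>L0 w = e w\<close> gives \<open>(n - e) w\<^sub>n = 0\<close> for all \<open>n\<close>.
\<close>

lemma negative_eigenvector_zero:
  assumes "graded_by scale L0 V" "L0 w = scale (of_int e) w" "e < 0"
  shows "w = 0"
proof -
  define components where "components v f \<longleftrightarrow>
    (\<forall>n. f n \<in> V n) \<and> finite {n. f n \<noteq> 0} \<and> v = (\<Sum>n | f n \<noteq> 0. f n)" for v f
  have L0: "module_hom scale scale L0" and sub: "\<And>n. subspace (V n)"
    and uniq: "\<And>v. \<exists>!f. components v f"
    and eig: "\<And>n v. v \<in> V n \<Longrightarrow> L0 v = scale (of_nat n) v"
    using assms(1) linear_hom
    unfolding graded_by_def direct_sum_decomposition_def components_def by blast+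
  obtain f where f: "\<And>n. f n \<in> V n" "finite {n. f n \<noteq> 0}" "w = (\<Sum>n | f n \<noteq> 0. f n)"
    using ex1_implies_ex[OF uniq[of w]] unfolding components_def by blast
  define g where "g n = scale (of_nat n - of_int e) (f n)" for n
  have ne: "of_nat n - of_int e \<noteq> (0::complex)" for n
  proof -
    have "int n - e \<noteq> 0" using assms(3) by linarith
    then have "(of_int (int n - e) :: complex) \<noteq> 0" by (simp only: of_int_eq_0_iff) simp
    then show ?thesis by simp
  qed
  then have supp: "{n. g n \<noteq> 0} = {n. f n \<noteq> 0}"
    by (simp add: g_def)
  have "(\<Sum>n | g n \<noteq> 0. g n) = L0 w - scale (of_int e) w"
    unfolding supp f(3)
    by (simp add: module_hom.sum[OF L0] eig[OF f(1)] g_def scale_left_diff_distrib sum_subtractf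
        scale_sum_right)
  then have "components 0 g"
    using f(1,2) assms(2) sub unfolding components_def supp
    by (auto simp: g_def intro: subspace_scale)
  moreover have "components 0 (\<lambda>_. 0)"
    using sub unfolding components_def by (auto intro: subspace_0)
  ultimately have "g = (\<lambda>_. 0)"
    using uniq[of 0] by blast
  then have "f n = 0" for n
    using ne[of n] g_def[of n] by (simp add: fun_eq_iff)
  then show ?thesis using f(3) by simp
qed

text \<open>
  On a vector of degree \<open>p\<close>, the mode \<open>B\<^sub>n\<close> of a homogeneous field of weight \<open>d\<close> produces
  degree \<open>p + d - n - 1\<close>, which is negative once \<open>n \<ge> p + d\<close>. A general vector has finitely many
  homogeneous components.
\<close>

lemma modes_truncate:
  assumes "graded_by scale L0 V" "homogeneous_field scale L0 B"
  shows "\<exists>N. \<forall>n\<ge>N. mode B n u = 0"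
proof -
  have L0: "module_hom scale scale L0"
    and decomp: "\<exists>f. (\<forall>n. f n \<in> V n) \<and> finite {n. f n \<noteq> 0} \<and> u = (\<Sum>n | f n \<noteq> 0. f n)"
    and eig: "\<And>n v. v \<in> V n \<Longrightarrow> L0 v = scale (of_nat n) v"
    using assms(1) linear_hom unfolding graded_by_def direct_sum_decomposition_def by blast+
  obtain d :: int where d:
    "\<And>n. commutator L0 (mode B n) = (\<lambda>v. scale (of_int (d - n - 1)) (mode B n v))"
    using assms(2) unfolding homogeneous_field_def by blast
  have B: "module_hom scale scale (mode B n)" for n
    using assms(2) linear_hom unfolding homogeneous_field_def end_series_def mode_def by blast
  have homogeneous: "mode B n v = 0" if "v \<in> V p" "n \<ge> int p + d" for n v p
  proof (rule negative_eigenvector_zero[OF assms(1)])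
    have "L0 (mode B n v) - scale (of_nat p) (mode B n v)
        = scale (of_int (d - n - 1)) (mode B n v)"
      using fun_cong[OF d[of n], of v]
      by (simp add: commutator_def eig[OF that(1)] module_hom.scale[OF B])
    then have "L0 (mode B n v)
        = scale (of_int (d - n - 1) + of_nat p) (mode B n v)"
      unfolding scale_left_distrib by (simp add: diff_eq_eq)
    then show "L0 (mode B n v) = scale (of_int (d - n - 1 + int p)) (mode B n v)"
      by simp
    show "d - n - 1 + int p < 0" using that(2) by simp
  qed
  obtain f where f: "\<And>n. f n \<in> V n" "finite {n. f n \<noteq> 0}" "u = (\<Sum>n | f n \<noteq> 0. f n)"
    using decomp by blast
  obtain q where q: "\<And>p. f p \<noteq> 0 \<Longrightarrow> p \<le> q"
    using f(2) unfolding finite_nat_set_iff_bounded_le by blast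
  have "mode B n u = 0" if "n \<ge> int q + d" for n
  proof -
    have "mode B n (f p) = 0" if "f p \<noteq> 0" for p
      using q[OF that] \<open>n \<ge> int q + d\<close> f(1) by (intro homogeneous[of _ p]) auto
    then show ?thesis
      by (subst f(3)) (simp add: module_hom.sum[OF B])
  qed
  then show ?thesis by blast
qed

section \<open>Fields annihilating vectors\<close>

text \<open>
  Moving \<open>D\<^sub>i\<close> past \<open>B\<^sub>s\<^sub>-\<^sub>i\<close> leaves only the commutator, in which the coefficient modes depend
  on \<open>s\<close> alone. Truncation makes the resulting polynomial in \<open>i\<close> vanish for all \<open>i \<le> s - N\<close>,
  hence identically.
\<close>

lemma annihilation_propagates:
  assumes "local_fields scale D B" "end_series scale D"
    and truncate: "\<exists>N. \<forall>n\<ge>N. mode B n u = 0"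
    and kills: "\<And>m. mode D m u = 0" and "end_series scale B"
  shows "mode D m (mode B k u) = 0"
proof -
  obtain M C where C: "\<And>m k. commutator (mode D m) (mode B k) =
       (\<lambda>v. \<Sum>l<M. scale (of_int m gchoose l) (mode (C l) (m + k - int l) v))"
    using assms(1) unfolding local_fields_def by blast
  obtain N where N: "\<And>n. n \<ge> N \<Longrightarrow> mode B n u = 0"
    using truncate by blast
  have D0: "mode D n 0 = 0" and B0: "mode B n 0 = 0" for n
    using assms(2,5) module_hom.zero[OF linear_hom]
    unfolding end_series_def mode_def by blast+
  define s where "s = m + k"
  have expand: "mode D i (mode B (s - i) u)
      = (\<Sum>l<M. scale (of_int i gchoose l) (mode (C l) (s - int l) u))" for i
    using fun_cong[OF C[of i "s - i"], of u] by (simp add: commutator_def kills B0)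
  have "(\<Sum>l<M. scale (of_int i gchoose l) (mode (C l) (s - int l) u)) = 0" if "i \<le> s - N" for i
    using that N[of "s - i"] D0 unfolding expand[symmetric] by simp
  then have "\<forall>l<M. mode (C l) (s - int l) u = 0"
    by (rule binomial_polynomial_vanishing)
  then show ?thesis
    using expand[of m] by (simp add: s_def)
qed

text \<open>
  The translation equation is a recursion for the coefficients of \<open>D(z) vac\<close>: for \<open>k \<ge> 0\<close>, the coefficient
  of \<open>z^(k + 1)\<close> is \<open>1 / (k + 1)\<close> times the image under \<open>T\<close> of that of \<open>z^k\<close>.
\<close>

lemma creation_determined:
  assumes "Vector_Spaces.linear scale scale T" "T vac = 0" "end_series scale D"
    and transl: "(\<lambda>k. commutator T (D k)) = series_deriv scale D"
    and neg: "\<And>k. k < 0 \<Longrightarrow> D k vac = 0" and "D 0 vac = 0"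
  shows "D k vac = 0"
proof -
  have "D (int n) vac = 0" for n
  proof (induction n)
    case 0
    then show ?case using assms(6) by simp
  next
    case (Suc n)
    have "T (D (int n) vac) - D (int n) (T vac)
        = scale (of_int (int n + 1)) (D (int n + 1) vac)"
      using fun_cong[OF fun_cong[OF transl, of "int n"], of vac]
      by (simp only: commutator_def series_deriv_def)
    moreover have "D (int n) 0 = 0" "T 0 = 0"
      using assms(1,3) module_hom.zero[OF linear_hom] unfolding end_series_def by blast+
    ultimately have "scale (of_int (int n + 1)) (D (int n + 1) vac) = 0"
      by (simp only: Suc.IH assms(2) diff_self)
    moreover have "(of_int (int n + 1) :: complex) \<noteq> 0"
      by (simp only: of_int_eq_0_iff)
    ultimately have "D (int n + 1) vac = 0"
      using scale_eq_0_iff by blast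
    then show ?case
      by (simp add: add.commute)
  qed
  then show ?thesis
    using neg[of k] by (metis linorder_not_less zero_le_imp_eq_int)
qed

end

section \<open>Goddard uniqueness\<close>

theorem proposition8p10:
  fixes scale :: "complex \<Rightarrow> 'v::ab_group_add \<Rightarrow> 'v"
    and V :: "nat \<Rightarrow> 'v set"
    and L0 Lm1 :: "'v \<Rightarrow> 'v"
    and E :: "'v formal_series set"
    and vac :: 'v
    and A1 A2 :: "'v formal_series"
  assumes "vector_space scale"
    and "graded_by scale L0 V"
    and "\<forall>A\<in>E. homogeneous_field scale L0 A"
    and "vac \<in> V 0"
    and "\<forall>A\<in>E. \<forall>k<0. A k vac = 0"
    and "Vector_Spaces.linear scale scale Lm1"
    and "Lm1 vac = 0"
    and "\<forall>A\<in>E. (\<lambda>k. commutator Lm1 (A k)) = series_deriv scale A"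
    and "module.span scale {mode_product xs vac | xs. \<forall>(A, n)\<in>set xs. A \<in> E} = UNIV"
    and "\<forall>A\<in>E. \<forall>B\<in>E. local_fields scale A B"
    and "A1 \<in> E" and "A2 \<in> E"
    and "mode A1 (-1) vac = mode A2 (-1) vac"
  shows "A1 = A2"
proof -
  interpret complex_space scale
    using assms(1) by (simp add: complex_space_def)
  define D where "D = (\<lambda>k v. A1 k v - A2 k v)"
  have lin: "end_series scale A" if "A \<in> E" for A
    using assms(3) that unfolding homogeneous_field_def by blast
  have D_lin: "end_series scale D"
    using lin[OF assms(11)] lin[OF assms(12)] linear_diff_fun
    unfolding end_series_def D_def by blast
  have D_local: "local_fields scale D B" if "B \<in> E" for B
    unfolding D_def using assms(10-12) lin that by (intro local_fields_diff) auto
  have D_transl: "(\<lambda>k. commutator Lm1 (D k)) = series_deriv scale D"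
  proof (intro ext)
    fix k v
    have "commutator Lm1 (D k) v = commutator Lm1 (A1 k) v - commutator Lm1 (A2 k) v"
      using module_hom.diff[OF linear_hom[OF assms(6)]] by (simp add: commutator_def D_def)
    also have "\<dots> = series_deriv scale A1 k v - series_deriv scale A2 k v"
      using assms(8,11,12) by metis
    finally show "commutator Lm1 (D k) v = series_deriv scale D k v"
      by (simp add: series_deriv_def D_def scale_right_diff_distrib)
  qed
  have D_vac: "D k vac = 0" for k
    using assms(6,7) D_lin D_transl
  proof (rule creation_determined)
    show "D k vac = 0" if "k < 0" for k
    proof -
      have "A1 k vac = 0" "A2 k vac = 0"
        using assms(5,11,12) that by blast+
      then show ?thesis by (simp add: D_def)
    qed
    show "D 0 vac = 0"
      using assms(13) by (simp add: D_def mode_def)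
  qed
  have D_products: "mode D m (mode_product xs vac) = 0" if "\<forall>(A, n)\<in>set xs. A \<in> E" for m xs
    using that
  proof (induction xs arbitrary: m)
    case Nil
    then show ?case by (simp add: mode_product_def mode_def D_vac)
  next
    case (Cons x xs)
    obtain B k where x: "x = (B, k)" by (cases x)
    with Cons.prems have B: "B \<in> E" and "\<forall>(A, n)\<in>set xs. A \<in> E" by auto
    then have "mode D m (mode B k (mode_product xs vac)) = 0"
      using assms(2,3) D_local D_lin lin Cons.IH
      by (intro annihilation_propagates modes_truncate) auto
    then show ?case by (simp add: mode_product_def x)
  qed
  have "D k v = 0" for k v
  proof -
    have "subspace {v. D k v = 0}"
      using D_lin module_hom.subspace_kernel[OF linear_hom] unfolding end_series_def by blast
    moreover have "{mode_product xs vac | xs. \<forall>(A, n)\<in>set xs. A \<in> E} \<subseteq> {v. D k v = 0}"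
      using D_products[where m = "- k - 1"] by (auto simp: mode_def)
    ultimately show ?thesis
      using span_minimal assms(9) by blast
  qed
  then show ?thesis
    by (auto simp: D_def fun_eq_iff)
qed

end
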